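(* Let $L$ be a left Leibniz algebra over a field $F$ which is not a Lie algebra, and suppose that every subalgebra of $L$ is either an ideal of $L$ or self-idealizing in $L$. Let $K=\mathrm{Ln}(L)$ and suppose that $L\neq K$, that $K$ is not cyclic and that $K$ is not abelian. If $\zeta(L)$ does not include $[K,K]$ (that is, $[K,K]\not\subseteq\zeta(L)$), then the following conditions hold: (i) $\mathrm{char}(F)\neq 2$; (ii) every subalgebra of $K$ is an ideal of $L$; (iii) $K$ is a strong extraspecial subalgebra; (iv) $[K,K]=\zeta(K)=\mathrm{Leib}(L)=\langle z\rangle$ has dimension $1$ (for some $z$); (v) $L=K+\langle v\rangle$ for some $v\in L$ such that $[v+\zeta(K),x+\zeta(K)]=x+\zeta(K)$ (in $L/\zeta(K)$) for each element $x\in K\setminus\zeta(K)$, $[v,z]=2z$ and $[v,v]=\nu z$ for some element $\nu\in F$ ($\nu$ can be zero).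
   Context: A left Leibniz algebra over $F$ is an $F$-vector space $L$ (of arbitrary dimension) with a bilinear bracket satisfying $[[a,b],c]=[a,[b,c]]-[b,[a,c]]$ for all $a,b,c\in L$. It is a Lie algebra iff $[a,a]=0$ for all $a\in L$. Ideals are two-sided. $\langle v\rangle$ is the subalgebra generated by $v$. An algebra is abelian if $[x,y]=0$ for all $x,y$ in it, and cyclic if it is generated as an algebra by one element. For a subalgebra $S$ of $L$, $\mathrm{I}_L(S)=\{x\in L \mid [x,s],[s,x]\in S \text{ for all } s\in S\}$; $S$ is self-idealizing in $L$ if $S=\mathrm{I}_L(S)$. The center is $\zeta(L)=\{x\in L\mid [x,y]=[y,x]=0 \text{ for all } y\in L\}$. $[K,K]$ is the subspace spanned by all $[x,y]$, $x,y\in K$. The Leibniz kernel $\mathrm{Leib}(L)$ is the subspace spanned by all $[a,a]$, $a\in L$; it is an ideal. An algebra is locally nilpotent if every finitely generated subalgebra is nilpotent. Every Leibniz algebra $L$ has a greatest locally nilpotent ideal, the locally nilpotent radical $\mathrm{Ln}(L)$. A Leibniz algebra $E$ is extraspecial if $\zeta(E)$ has dimension $1$ and $E/\zeta(E)$ is abelian; it is strong extraspecial if moreover $[x,x]\neq 0$ for each $x\in E\setminus\zeta(E)$. *)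

theory Defs
  imports Complex_Main
begin

text \<open>The whole algebra $L$ is the universe of the type \<^typ>\<open>'a\<close>, so its dimension is arbitrary;
  subalgebras and ideals are sets. The parameter \<open>s\<close> is the scalar multiplication and \<open>br\<close> the bracket.\<close>

locale left_leibniz_algebra = vector_space s
  for s :: "'f::field \<Rightarrow> 'a::ab_group_add \<Rightarrow> 'a" +
  fixes br :: "'a \<Rightarrow> 'a \<Rightarrow> 'a"
  assumes br_add_left: "br (x + y) z = br x z + br y z"
    and br_add_right: "br x (y + z) = br x y + br x z"
    and br_scale_left: "br (s c x) y = s c (br x y)"
    and br_scale_right: "br x (s c y) = s c (br x y)"
    and leibniz: "br (br x y) z = br x (br y z) - br y (br x z)"

definition is_lie :: "('a::ab_group_add \<Rightarrow> 'a \<Rightarrow> 'a) \<Rightarrow> bool" where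
  "is_lie br \<longleftrightarrow> (\<forall>a. br a a = 0)"

definition subalgebra ::
    "('f::field \<Rightarrow> 'a::ab_group_add \<Rightarrow> 'a) \<Rightarrow> ('a \<Rightarrow> 'a \<Rightarrow> 'a) \<Rightarrow> 'a set \<Rightarrow> bool" where
  "subalgebra s br S \<longleftrightarrow> module.subspace s S \<and> (\<forall>x\<in>S. \<forall>y\<in>S. br x y \<in> S)"

definition lideal ::
    "('f::field \<Rightarrow> 'a::ab_group_add \<Rightarrow> 'a) \<Rightarrow> ('a \<Rightarrow> 'a \<Rightarrow> 'a) \<Rightarrow> 'a set \<Rightarrow> bool" where
  "lideal s br I \<longleftrightarrow> module.subspace s I \<and> (\<forall>x\<in>I. \<forall>y. br x y \<in> I \<and> br y x \<in> I)"

definition gen_subalgebra ::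
    "('f::field \<Rightarrow> 'a::ab_group_add \<Rightarrow> 'a) \<Rightarrow> ('a \<Rightarrow> 'a \<Rightarrow> 'a) \<Rightarrow> 'a set \<Rightarrow> 'a set" where
  "gen_subalgebra s br X = subalgebra s br hull X"

definition idealizer :: "('a \<Rightarrow> 'a \<Rightarrow> 'a) \<Rightarrow> 'a set \<Rightarrow> 'a set" where
  "idealizer br S = {x. \<forall>t\<in>S. br x t \<in> S \<and> br t x \<in> S}"

definition self_idealizing :: "('a \<Rightarrow> 'a \<Rightarrow> 'a) \<Rightarrow> 'a set \<Rightarrow> bool" where
  "self_idealizing br S \<longleftrightarrow> S = idealizer br S"

definition lcenter :: "('a::ab_group_add \<Rightarrow> 'a \<Rightarrow> 'a) \<Rightarrow> 'a set \<Rightarrow> 'a set" where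
  "lcenter br A = {x\<in>A. \<forall>y\<in>A. br x y = 0 \<and> br y x = 0}"

definition br_span ::
    "('f::field \<Rightarrow> 'a::ab_group_add \<Rightarrow> 'a) \<Rightarrow> ('a \<Rightarrow> 'a \<Rightarrow> 'a) \<Rightarrow> 'a set \<Rightarrow> 'a set \<Rightarrow> 'a set" where
  "br_span s br A B = module.span s {br x y | x y. x \<in> A \<and> y \<in> B}"

definition leib_kernel ::
    "('f::field \<Rightarrow> 'a::ab_group_add \<Rightarrow> 'a) \<Rightarrow> ('a \<Rightarrow> 'a \<Rightarrow> 'a) \<Rightarrow> 'a set" where
  "leib_kernel s br = module.span s {br a a | a. True}"

definition abelian_alg :: "('a::ab_group_add \<Rightarrow> 'a \<Rightarrow> 'a) \<Rightarrow> 'a set \<Rightarrow> bool" where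
  "abelian_alg br A \<longleftrightarrow> (\<forall>x\<in>A. \<forall>y\<in>A. br x y = 0)"

definition cyclic_alg ::
    "('f::field \<Rightarrow> 'a::ab_group_add \<Rightarrow> 'a) \<Rightarrow> ('a \<Rightarrow> 'a \<Rightarrow> 'a) \<Rightarrow> 'a set \<Rightarrow> bool" where
  "cyclic_alg s br A \<longleftrightarrow> (\<exists>x\<in>A. A = gen_subalgebra s br {x})"

text \<open>By the left Leibniz identity every product of $n$ factors is a linear combination of
  right-normed ones, so $[A,[A,\dots]]$ is the lower central series; \<open>lower_central s br A n\<close> is
  the term usually written $\gamma_{n+1}(A)$.\<close>

primrec lower_central ::
    "('f::field \<Rightarrow> 'a::ab_group_add \<Rightarrow> 'a) \<Rightarrow> ('a \<Rightarrow> 'a \<Rightarrow> 'a) \<Rightarrow> 'a set \<Rightarrow> nat \<Rightarrow> 'a set" where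
  "lower_central s br A 0 = A"
| "lower_central s br A (Suc n) = br_span s br A (lower_central s br A n)"

definition nilpotent_alg ::
    "('f::field \<Rightarrow> 'a::ab_group_add \<Rightarrow> 'a) \<Rightarrow> ('a \<Rightarrow> 'a \<Rightarrow> 'a) \<Rightarrow> 'a set \<Rightarrow> bool" where
  "nilpotent_alg s br A \<longleftrightarrow> (\<exists>n. lower_central s br A n = {0})"

definition locally_nilpotent ::
    "('f::field \<Rightarrow> 'a::ab_group_add \<Rightarrow> 'a) \<Rightarrow> ('a \<Rightarrow> 'a \<Rightarrow> 'a) \<Rightarrow> 'a set \<Rightarrow> bool" where
  "locally_nilpotent s br A \<longleftrightarrow>
     (\<forall>X. finite X \<and> X \<subseteq> A \<longrightarrow> nilpotent_alg s br (gen_subalgebra s br X))"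

definition is_ln_radical ::
    "('f::field \<Rightarrow> 'a::ab_group_add \<Rightarrow> 'a) \<Rightarrow> ('a \<Rightarrow> 'a \<Rightarrow> 'a) \<Rightarrow> 'a set \<Rightarrow> bool" where
  "is_ln_radical s br K \<longleftrightarrow>
     lideal s br K \<and> locally_nilpotent s br K \<and>
     (\<forall>J. lideal s br J \<and> locally_nilpotent s br J \<longrightarrow> J \<subseteq> K)"

lemma is_ln_radical_unique: "is_ln_radical s br K \<Longrightarrow> is_ln_radical s br K' \<Longrightarrow> K = K'"
  by (auto simp: is_ln_radical_def)

definition lcoset :: "'a::ab_group_add set \<Rightarrow> 'a \<Rightarrow> 'a set" where
  "lcoset I x = {x + t | t. t \<in> I}"

definition lquot :: "'a::ab_group_add set \<Rightarrow> 'a set \<Rightarrow> 'a set set" where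
  "lquot A I = {lcoset I x | x. x \<in> A}"

definition quot_br ::
    "('a::ab_group_add \<Rightarrow> 'a \<Rightarrow> 'a) \<Rightarrow> 'a set \<Rightarrow> 'a set \<Rightarrow> 'a set \<Rightarrow> 'a set" where
  "quot_br br I X Y = {br x y + t | x y t. x \<in> X \<and> y \<in> Y \<and> t \<in> I}"

lemma (in left_leibniz_algebra) quot_br_lcoset:
  assumes sub: "subspace I" and IA: "I \<subseteq> A" and xy: "x \<in> A" "y \<in> A"
    and I: "\<And>a b. a \<in> I \<Longrightarrow> b \<in> A \<Longrightarrow> br a b \<in> I \<and> br b a \<in> I"
  shows "quot_br br I (lcoset I x) (lcoset I y) = lcoset I (br x y)"
proof
  show "quot_br br I (lcoset I x) (lcoset I y) \<subseteq> lcoset I (br x y)"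
  proof
    fix u assume "u \<in> quot_br br I (lcoset I x) (lcoset I y)"
    then obtain a b t where abt: "a \<in> I" "b \<in> I" "t \<in> I" and u: "u = br (x + a) (y + b) + t"
      by (auto simp: quot_br_def lcoset_def)
    have "br x b \<in> I" "br a y \<in> I" "br a b \<in> I"
      using abt xy I IA by blast+
    then have "br x b + br a y + br a b + t \<in> I"
      using abt by (intro subspace_add[OF sub])
    moreover have "u = br x y + (br x b + br a y + br a b + t)"
      by (simp add: u br_add_left br_add_right algebra_simps)
    ultimately show "u \<in> lcoset I (br x y)"
      unfolding lcoset_def by blast
  qed
  show "lcoset I (br x y) \<subseteq> quot_br br I (lcoset I x) (lcoset I y)"
  proof
    fix u assume "u \<in> lcoset I (br x y)"
    then obtain t where "t \<in> I" "u = br x y + t" by (auto simp: lcoset_def)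
    moreover have "w \<in> lcoset I w" for w
      using subspace_0[OF sub] by (auto simp: lcoset_def intro: exI[of _ 0])
    ultimately show "u \<in> quot_br br I (lcoset I x) (lcoset I y)"
      unfolding quot_br_def by blast
  qed
qed

definition extraspecial ::
    "('f::field \<Rightarrow> 'a::ab_group_add \<Rightarrow> 'a) \<Rightarrow> ('a \<Rightarrow> 'a \<Rightarrow> 'a) \<Rightarrow> 'a set \<Rightarrow> bool" where
  "extraspecial s br E \<longleftrightarrow>
     subalgebra s br E \<and> vector_space.dim s (lcenter br E) = 1 \<and>
     (\<forall>X\<in>lquot E (lcenter br E). \<forall>Y\<in>lquot E (lcenter br E).
        quot_br br (lcenter br E) X Y = lcoset (lcenter br E) 0)"

definition strong_extraspecial ::
    "('f::field \<Rightarrow> 'a::ab_group_add \<Rightarrow> 'a) \<Rightarrow> ('a \<Rightarrow> 'a \<Rightarrow> 'a) \<Rightarrow> 'a set \<Rightarrow> bool" where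
  "strong_extraspecial s br E \<longleftrightarrow>
     extraspecial s br E \<and> (\<forall>x\<in>E - lcenter br E. br x x \<noteq> 0)"

end

theory Submission
  imports Defs
begin

text \<open>Since $K$ is locally nilpotent and not cyclic, no cyclic subalgebra of $K$ is self-idealizing,
  so all subalgebras of $K$ are ideals of $L$. Hence elements of $K$ with zero square are central in
  $K$, each $[x,y]$ is a multiple of both $[x,x]$ and $[y,y]$, and comparing with $(x+y)^2$ shows that
  all squares lie on one line $Fz$. As $[K,K] = Fz$ is not central in $L$, some $v$ acts on $z$ by a
  nonzero scalar $\delta$. It acts on $\zeta(K)$ by $\delta$, and, by the derivation rule for $[x,x]$,
  on $K/\zeta(K)$ by $\alpha$ with $2\alpha = \delta$; hence $2 \neq 0$, and $\alpha \neq \delta$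
  forces $\zeta(K) = Fz$. Finally, if $[u,z] = 0$ then $Fu + Fz$ is idealized by $K$, so unless
  $u \in K$ it is a nilpotent ideal, which is contained in $K$ all the same; so $K$ is the kernel of
  the action on $z$ and has codimension one.\<close>

section \<open>Bilinearity, spans and generated subalgebras\<close>

context left_leibniz_algebra
begin

lemma br_zero_left [simp]: "br 0 y = 0"
  using br_add_left[of 0 0 y] by simp

lemma br_zero_right [simp]: "br x 0 = 0"
  using br_add_right[of x 0 0] by simp

lemma br_diff_left: "br (x - y) z = br x z - br y z"
  using br_add_left[of "x - y" y z] by (simp add: algebra_simps)

lemma br_diff_right: "br x (y - z) = br x y - br x z"
  using br_add_right[of x "y - z" z] by (simp add: algebra_simps)

lemmas br_linear = br_add_left br_add_right br_diff_left br_diff_right br_scale_left br_scale_right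

lemma mem_span_singleton: "x \<in> span {a} \<longleftrightarrow> (\<exists>c. x = s c a)"
  by (auto simp: span_singleton)

lemma mem_span_pair: "x \<in> span {a, b} \<longleftrightarrow> (\<exists>c d. x = s c a + s d b)"
proof -
  have "x - s c a = y \<longleftrightarrow> x = s c a + y" for c y
    by (auto simp: algebra_simps)
  then show ?thesis
    by (auto simp: span_insert[of a] mem_span_singleton)
qed

text \<open>Reduces containment of products to spanning sets. A fixed factor \<open>y\<close> enters
  later as a member of \<open>span {y}\<close>.\<close>

lemma br_mem_span:
  assumes "x \<in> span A" "y \<in> span B" and "subspace V"
    and AB: "\<And>a b. a \<in> A \<Longrightarrow> b \<in> B \<Longrightarrow> br a b \<in> V"
  shows "br x y \<in> V"
proof -
  have "br a y \<in> V" if "a \<in> A" for a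
    using \<open>y \<in> span B\<close>
  proof (induction rule: span_induct_alt)
    case base
    show ?case using subspace_0[OF \<open>subspace V\<close>] by simp
  next
    case (step c b y)
    then show ?case
      using AB[OF that] \<open>subspace V\<close> by (simp add: br_linear subspace_add subspace_scale)
  qed
  with \<open>x \<in> span A\<close> show ?thesis
  proof (induction rule: span_induct_alt)
    case base
    show ?case using subspace_0[OF \<open>subspace V\<close>] by simp
  next
    case (step c a x)
    then show ?case
      using \<open>subspace V\<close> by (simp add: br_linear subspace_add subspace_scale)
  qed
qed

lemma subalgebra_span:
  assumes "\<And>a b. a \<in> A \<Longrightarrow> b \<in> A \<Longrightarrow> br a b \<in> span A"
  shows "subalgebra s br (span A)"
  unfolding subalgebra_def using br_mem_span[OF _ _ subspace_span assms] by auto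

lemma subalgebra_gen: "subalgebra s br (gen_subalgebra s br X)"
  unfolding gen_subalgebra_def
proof (rule hull_in)
  fix T assume "Ball T (subalgebra s br)"
  then show "subalgebra s br (\<Inter>T)"
    unfolding subalgebra_def by (auto intro!: subspace_Inter)
qed

lemma gen_superset: "X \<subseteq> gen_subalgebra s br X"
  unfolding gen_subalgebra_def by (rule hull_subset)

lemma gen_minimal: "X \<subseteq> S \<Longrightarrow> subalgebra s br S \<Longrightarrow> gen_subalgebra s br X \<subseteq> S"
  unfolding gen_subalgebra_def by (rule hull_minimal)

section \<open>Lower central series and local nilpotency\<close>

lemma br_mem_br_span: "a \<in> A \<Longrightarrow> b \<in> B \<Longrightarrow> br a b \<in> br_span s br A B"
  unfolding br_span_def by (intro span_base) blast

lemma br_span_subset: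
  assumes "subspace V" and "\<And>a b. a \<in> A \<Longrightarrow> b \<in> B \<Longrightarrow> br a b \<in> V"
  shows "br_span s br A B \<subseteq> V"
  unfolding br_span_def using assms by (intro span_minimal) auto

lemma br_span_mono: "A \<subseteq> A' \<Longrightarrow> B \<subseteq> B' \<Longrightarrow> br_span s br A B \<subseteq> br_span s br A' B'"
  unfolding br_span_def by (intro span_mono) blast

lemma subspace_lower_central: "subspace A \<Longrightarrow> subspace (lower_central s br A n)"
  by (cases n) (auto simp: br_span_def)

lemma lower_central_mono: "A \<subseteq> B \<Longrightarrow> lower_central s br A n \<subseteq> lower_central s br B n"
  by (induction n) (auto intro: br_span_mono[THEN subsetD])

text \<open>Induction on the left factor: the Leibniz identity turns [[a,b],c] into [a,[b,c]] and
  [b,[a,c]], whose left factors have smaller weight. Indices are one below the usual ones, hence the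
  \<open>Suc\<close>.\<close>

lemma br_lower_central:
  assumes "subspace A" and "x \<in> lower_central s br A i" and "y \<in> lower_central s br A j"
  shows "br x y \<in> lower_central s br A (Suc (i + j))"
  using assms(2,3)
proof (induction i arbitrary: x y j)
  case 0
  then show ?case by (simp add: br_mem_br_span)
next
  case (Suc i)
  let ?V = "lower_central s br A (Suc (Suc i + j))"
  have V: "subspace ?V"
    using \<open>subspace A\<close> by (rule subspace_lower_central)
  show ?case
  proof (rule br_mem_span[OF _ _ V])
    show "x \<in> span {br a b | a b. a \<in> A \<and> b \<in> lower_central s br A i}"
      using Suc.prems(1) by (simp add: br_span_def)
    show "y \<in> span (lower_central s br A j)"
      using Suc.prems(2) by (rule span_base)
    fix u c assume "u \<in> {br a b | a b. a \<in> A \<and> b \<in> lower_central s br A i}"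
      and c: "c \<in> lower_central s br A j"
    then obtain a b where ab: "u = br a b" "a \<in> A" "b \<in> lower_central s br A i"
      by blast
    have "br a (br b c) \<in> ?V"
      using br_mem_br_span[OF \<open>a \<in> A\<close> Suc.IH[OF ab(3) c]] by simp
    moreover have "br a c \<in> lower_central s br A (Suc j)"
      using br_mem_br_span[OF \<open>a \<in> A\<close> c] by simp
    \<comment> \<open>Here the induction hypothesis is applied with \<open>Suc j\<close> in place of
      \<open>j\<close>, which is why \<open>j\<close> is kept arbitrary.\<close>
    then have "br b (br a c) \<in> ?V"
      using Suc.IH[OF ab(3)] by fastforce
    ultimately show "br u c \<in> ?V"
      unfolding ab(1) leibniz by (rule subspace_diff[OF V])
  qed
qed

lemma lcoset_add_mem:
  assumes "subspace I" "t \<in> I"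
  shows "lcoset I (x + t) = lcoset I x"
proof -
  have "x + t + w = x + (t + w)" "x + w = x + t + (w - t)" for w
    by simp_all
  then show ?thesis
    unfolding lcoset_def using subspace_add[OF assms] subspace_diff[OF assms(1) _ assms(2)] by blast
qed

lemma locally_nilpotent_class_two:
  assumes "subalgebra s br J"
    and "\<And>a b c. a \<in> J \<Longrightarrow> b \<in> J \<Longrightarrow> c \<in> J \<Longrightarrow> br a (br b c) = 0"
  shows "locally_nilpotent s br J"
  unfolding locally_nilpotent_def nilpotent_alg_def
proof (intro allI impI exI)
  fix X assume X: "finite X \<and> X \<subseteq> J"
  let ?G = "gen_subalgebra s br X"
  have "br a u \<in> {0}" if "a \<in> J" "u \<in> br_span s br J J" for a u
    using span_base[OF that(1)] that(2)[unfolded br_span_def]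
    by (rule br_mem_span) (auto simp: assms(2))
  then have "lower_central s br J 2 \<subseteq> {0}"
    unfolding numeral_2_eq_2 lower_central.simps by (intro br_span_subset) simp_all
  moreover have "lower_central s br ?G 2 \<subseteq> lower_central s br J 2"
    using X assms(1) by (intro lower_central_mono gen_minimal) auto
  moreover have "0 \<in> lower_central s br ?G 2"
    using subalgebra_gen[of X] by (intro subspace_0 subspace_lower_central) (simp add: subalgebra_def)
  ultimately show "lower_central s br ?G 2 = {0}" by blast
qed

text \<open>The normalizer condition. Take the first term of the lower central series inside
  \<open>S\<close>; an element \<open>w\<close> of the preceding term outside \<open>S\<close>
  multiplies \<open>A\<close>, and so \<open>S\<close>, into \<open>S\<close>.\<close>

lemma nilpotent_idealizer_grows:
  assumes "subalgebra s br A" "nilpotent_alg s br A"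
    and "subspace S" "S \<subset> A"
  obtains w where "w \<in> idealizer br S" "w \<notin> S"
proof -
  let ?P = "\<lambda>n. lower_central s br A n \<subseteq> S"
  have "\<exists>n. ?P n"
    using assms(2) subspace_0[OF assms(3)]
    unfolding nilpotent_alg_def by (metis empty_subsetI insert_subset)
  then obtain n where n: "?P n" and least: "\<And>m. m < n \<Longrightarrow> \<not> ?P m"
    using exists_least_iff[of ?P] by blast
  \<comment> \<open>Term 0 is \<open>A\<close> itself, which is not contained in \<open>S\<close>,
    so \<open>n\<close> is positive.\<close>
  with assms(4) obtain m where m: "n = Suc m"
    by (cases n) auto
  obtain w where w: "w \<in> lower_central s br A m" "w \<notin> S"
    using least[of m] m by blast
  have A: "subspace A"
    using assms(1) by (simp add: subalgebra_def)
  have "br w t \<in> S \<and> br t w \<in> S" if "t \<in> S" for t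
    using br_lower_central[OF A w(1), of t 0] br_lower_central[OF A _ w(1), of t 0] that assms(4) n m
    by auto
  with w that show thesis
    by (auto simp: idealizer_def)
qed

text \<open>Left multiplication by \<open>y\<close> is nilpotent on the subalgebra generated by
  \<open>y\<close> and \<open>p\<close>. If \<open>c\<close> were nonzero, p = c^-1 [y,p] would put
  \<open>p\<close> into every term of its lower central series.\<close>

lemma locally_nilpotent_eigenvector:
  assumes "locally_nilpotent s br A" "y \<in> A" "p \<in> A" "br y p = s c p"
  shows "c = 0 \<or> p = 0"
proof (rule ccontr)
  assume nz: "\<not> ?thesis"
  let ?G = "gen_subalgebra s br {y, p}"
  have G: "y \<in> ?G" "p \<in> ?G" "subspace ?G"
    using gen_superset[of "{y, p}"] subalgebra_gen by (auto simp: subalgebra_def)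
  have "p \<in> lower_central s br ?G n" for n
  proof (induction n)
    case 0
    show ?case using G by simp
  next
    case (Suc n)
    have "s (inverse c) (br y p) \<in> lower_central s br ?G (Suc n)"
      using br_mem_br_span[OF G(1) Suc] subspace_lower_central[OF G(3), of "Suc n"]
      by (intro subspace_scale) auto
    then show ?case
      using nz assms(4) by simp
  qed
  moreover have "nilpotent_alg s br ?G"
    using assms by (auto simp: locally_nilpotent_def)
  ultimately show False
    using nz by (auto simp: nilpotent_alg_def)
qed

section \<open>The center and the Leibniz kernel\<close>

lemma subspace_lcenter: "subspace A \<Longrightarrow> subspace (lcenter br A)"
  by (auto simp: subspace_def lcenter_def br_linear)

lemma br_square_left [simp]: "br (br a a) y = 0"
  by (simp add: leibniz)

lemma square_mem_leib_kernel: "br a a \<in> leib_kernel s br"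
  unfolding leib_kernel_def by (intro span_base) blast

lemma subspace_leib_kernel: "subspace (leib_kernel s br)"
  unfolding leib_kernel_def by simp

text \<open>Polarization of the square of \<open>a + b\<close>, valid in every
  characteristic.\<close>

lemma br_sym_mem_leib_kernel: "br a b + br b a \<in> leib_kernel s br"
proof -
  have "br a b + br b a = br (a + b) (a + b) - br a a - br b b"
    by (simp add: br_linear)
  then show ?thesis
    using square_mem_leib_kernel subspace_leib_kernel by (auto intro!: subspace_diff)
qed

lemma br_leib_kernel_left:
  assumes "u \<in> leib_kernel s br"
  shows "br u y = 0"
proof -
  have "br u y \<in> {0}"
    using assms[unfolded leib_kernel_def] span_base[of y "{y}"]
    by (rule br_mem_span) auto
  then show ?thesis by simp
qed

text \<open>Left multiplication by y is a derivation, so it sends [a,a] to the symmetric sum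
  [[y,a],a] + [a,[y,a]]; products in the other order vanish.\<close>

lemma lideal_leib_kernel: "lideal s br (leib_kernel s br)"
proof -
  have "br y u \<in> leib_kernel s br" if "u \<in> leib_kernel s br" for u y
    using span_base[of y "{y}"] that[unfolded leib_kernel_def] subspace_leib_kernel
  proof (rule br_mem_span)
    fix y' v assume "y' \<in> {y}" "v \<in> {br a a | a. True}"
    then obtain a where "v = br a a" by blast
    then have "br y' v = br (br y' a) a + br a (br y' a)"
      by (simp add: leibniz)
    then show "br y' v \<in> leib_kernel s br"
      using br_sym_mem_leib_kernel by simp
  qed simp
  then show ?thesis
    by (auto simp: lideal_def subspace_leib_kernel br_leib_kernel_left subspace_0)
qed

lemma lideal_imp_subalgebra: "lideal s br I \<Longrightarrow> subalgebra s br I"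
  by (auto simp: lideal_def subalgebra_def)

lemma lideal_br_left: "lideal s br I \<Longrightarrow> x \<in> I \<Longrightarrow> br x y \<in> I"
  and lideal_br_right: "lideal s br I \<Longrightarrow> x \<in> I \<Longrightarrow> br y x \<in> I"
  by (auto simp: lideal_def)

lemma leib_kernel_subset_ln_radical:
  assumes "is_ln_radical s br K"
  shows "leib_kernel s br \<subseteq> K"
proof -
  have "locally_nilpotent s br (leib_kernel s br)"
    using lideal_leib_kernel
    by (intro locally_nilpotent_class_two lideal_imp_subalgebra) (auto simp: br_leib_kernel_left)
  then show ?thesis
    using assms lideal_leib_kernel by (auto simp: is_ln_radical_def)
qed

end

section \<open>Subalgebras of the radical are ideals\<close>

locale leibniz_ideal_or_self_idealizing = left_leibniz_algebra +
  fixes K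
  assumes dichotomy: "subalgebra s br S \<Longrightarrow> lideal s br S \<or> self_idealizing br S"
    and radical: "is_ln_radical s br K"
    and not_cyclic: "\<not> cyclic_alg s br K"
begin

lemma K_locally_nilpotent: "locally_nilpotent s br K"
  and K_lideal: "lideal s br K"
  using radical by (auto simp: is_ln_radical_def)

lemma K_subspace: "subspace K"
  and K_br_left: "x \<in> K \<Longrightarrow> br x y \<in> K"
  using K_lideal by (auto simp: lideal_def)

lemma K_subalgebra: "subalgebra s br K"
  using K_lideal by (rule lideal_imp_subalgebra)

lemma subspace_lcenter_K: "subspace (lcenter br K)"
  using K_subspace by (rule subspace_lcenter)

text \<open>As \<open>K\<close> itself may fail to be nilpotent, the normalizer condition is applied
  in the nilpotent subalgebra generated by \<open>x\<close> and one further \<open>y\<close> of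
  \<open>K\<close> outside the subalgebra of \<open>x\<close>.\<close>

lemma lideal_gen_singleton:
  assumes "x \<in> K"
  shows "lideal s br (gen_subalgebra s br {x})"
proof -
  let ?S = "gen_subalgebra s br {x}"
  have "?S \<subseteq> K"
    using assms K_subalgebra by (intro gen_minimal) auto
  moreover have "?S \<noteq> K"
    using not_cyclic assms by (auto simp: cyclic_alg_def)
  ultimately obtain y where y: "y \<in> K" "y \<notin> ?S" by blast
  let ?A = "gen_subalgebra s br {x, y}"
  have xy: "x \<in> ?A" "y \<in> ?A"
    using gen_superset[of "{x, y}"] by auto
  then have "?S \<subset> ?A"
    using gen_minimal[of "{x}" ?A] subalgebra_gen y by auto
  moreover have "nilpotent_alg s br ?A"
    using K_locally_nilpotent assms y by (auto simp: locally_nilpotent_def)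
  ultimately obtain w where "w \<in> idealizer br ?S" "w \<notin> ?S"
    using nilpotent_idealizer_grows[of ?A ?S] subalgebra_gen by (auto simp: subalgebra_def)
  then show ?thesis
    using dichotomy[OF subalgebra_gen] by (auto simp: self_idealizing_def)
qed

text \<open>\<open>S\<close> is the union of its cyclic subalgebras, each of which is an ideal of
  the whole algebra.\<close>

lemma subalgebra_imp_lideal:
  assumes "subalgebra s br S" "S \<subseteq> K"
  shows "lideal s br S"
proof -
  have "br x y \<in> S \<and> br y x \<in> S" if "x \<in> S" for x y
  proof -
    have "gen_subalgebra s br {x} \<subseteq> S" "x \<in> gen_subalgebra s br {x}"
      using that gen_minimal[OF _ assms(1), of "{x}"] gen_superset[of "{x}"] by auto
    moreover have "lideal s br (gen_subalgebra s br {x})"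
      using that assms(2) by (intro lideal_gen_singleton) blast
    ultimately show ?thesis
      using lideal_br_left lideal_br_right by blast
  qed
  then show ?thesis
    using assms by (auto simp: lideal_def subalgebra_def)
qed

section \<open>Squares and products inside the radical\<close>

lemma lideal_span_singleton:
  assumes "t \<in> K" "br t t = 0"
  shows "lideal s br (span {t})"
  using assms K_subspace
  by (intro subalgebra_imp_lideal subalgebra_span span_minimal) (auto simp: span_zero)

lemma square_zero_imp_central:
  assumes "t \<in> K" "br t t = 0"
  shows "t \<in> lcenter br K"
proof -
  have "br t y = 0 \<and> br y t = 0" if "y \<in> K" for y
  proof -
    obtain c d where c: "br y t = s c t" and d: "br t y = s d t"
      using lideal_br_right[OF lideal_span_singleton[OF assms] span_base, of t y]
        lideal_br_left[OF lideal_span_singleton[OF assms] span_base, of t y]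
      by (auto simp: mem_span_singleton)
    have yt: "br y t = 0"
      using locally_nilpotent_eigenvector[OF K_locally_nilpotent that assms(1) c] c by auto
    \<comment> \<open>With [y,t] = 0 the symmetric sum is [t,y] = d t itself. It annihilates
      \<open>y\<close> from the left, which gives d^2 t = 0.\<close>
    then have "s d t \<in> leib_kernel s br"
      using br_sym_mem_leib_kernel[of y t] d by simp
    then have "s d (s d t) = 0"
      using br_leib_kernel_left[of "s d t" y] d by (simp add: br_linear)
    then show ?thesis
      using yt d by auto
  qed
  then show ?thesis
    using assms by (auto simp: lcenter_def)
qed

lemma lcenter_iff_square: "x \<in> lcenter br K \<longleftrightarrow> x \<in> K \<and> br x x = 0"
  by (auto intro: square_zero_imp_central) (simp_all add: lcenter_def)

lemma square_central: "x \<in> K \<Longrightarrow> br x x \<in> lcenter br K"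
  by (simp add: lcenter_iff_square K_br_left)

lemma lideal_span_square:
  assumes "x \<in> K"
  shows "lideal s br (span {x, br x x})"
proof -
  have "br x (br x x) = 0"
    using square_central[OF assms] assms by (auto simp: lcenter_def)
  then show ?thesis
    using assms K_subspace K_br_left
    by (intro subalgebra_imp_lideal subalgebra_span span_minimal) (auto simp: span_base span_zero)
qed

text \<open>The ideal spanned by x and [x,x] contains both products; the task is to remove their
  x-components. Local nilpotency does this for [y,x], the Leibniz kernel for [x,y].\<close>

lemma br_mem_span_square:
  assumes "x \<in> K" "y \<in> K"
  shows "br y x \<in> span {br x x}" "br x y \<in> span {br x x}"
proof -
  let ?q = "br x x"
  have q: "br y ?q = 0" "br x ?q = 0"
    using square_central[OF assms(1)] assms by (auto simp: lcenter_def)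
  obtain a b c d where ab: "br y x = s a x + s b ?q" and cd: "br x y = s c x + s d ?q"
    using lideal_br_right[OF lideal_span_square[OF assms(1)] span_base, of x y]
      lideal_br_left[OF lideal_span_square[OF assms(1)] span_base, of x y]
    by (auto simp: mem_span_pair)
  \<comment> \<open>As \<open>y\<close> annihilates \<open>?q\<close>, the product [y,x] is an
    eigenvector of \<open>y\<close> with eigenvalue \<open>a\<close>.\<close>
  have "br y (br y x) = s a (br y x)"
    by (subst ab) (simp add: br_linear q)
  then have "a = 0 \<or> br y x = 0"
    using locally_nilpotent_eigenvector[OF K_locally_nilpotent] assms K_br_left by blast
  then show yx: "br y x \<in> span {?q}"
    using ab by (auto simp: span_zero span_base span_scale)
  then obtain e where e: "br y x = s e ?q"
    by (auto simp: mem_span_singleton)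
  \<comment> \<open>Multiplying the symmetric sum by \<open>x\<close> on the right isolates
    \<open>c\<close>: the multiples of \<open>?q\<close> annihilate \<open>x\<close>.\<close>
  have "br (br x y + br y x) x = 0"
    using br_sym_mem_leib_kernel by (rule br_leib_kernel_left)
  then have "s c ?q = 0"
    unfolding cd e by (simp add: br_linear)
  then have "c = 0 \<or> ?q = 0" by simp
  then show "br x y \<in> span {?q}"
  proof
    assume "?q = 0"
    then have "br x y = 0"
      using square_zero_imp_central[OF assms(1)] assms by (auto simp: lcenter_def)
    then show ?thesis by (simp add: span_zero)
  qed (simp add: cd span_base span_scale)
qed

text \<open>If the squares p of x0 and q of x were independent, the mixed products would lie on both
  lines and vanish. Then x0 + x has square p + q, and [x0, x0 + x] = p would be a multiple of
  it.\<close>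

lemma br_mem_span_any_square:
  assumes "x0 \<in> K" "br x0 x0 \<noteq> 0" "x \<in> K" "y \<in> K"
  shows "br x y \<in> span {br x0 x0}"
proof -
  have "br x x \<in> span {br x0 x0}"
  proof (rule ccontr)
    assume neg: "br x x \<notin> span {br x0 x0}"
    define p q where "p = br x0 x0" and "q = br x x"
    have qp: "q \<notin> span {p}" "p \<noteq> 0"
      using neg assms by (auto simp: p_def q_def)
    have disjoint: "u = 0" if u: "u \<in> span {p}" "u \<in> span {q}" for u
    proof (rule ccontr)
      assume "u \<noteq> 0"
      obtain c where c: "u = s c q" using u(2) by (auto simp: mem_span_singleton)
      with \<open>u \<noteq> 0\<close> have "q = s (inverse c) u" by auto
      with u(1) qp show False by (simp add: span_scale)
    qed
    have "br x x0 = 0" "br x0 x = 0"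
      using br_mem_span_square assms by (auto intro!: disjoint simp: p_def q_def)
    then have "br (x0 + x) (x0 + x) = p + q" "br x0 (x0 + x) = p"
      by (simp_all add: br_linear p_def q_def)
    then have "p \<in> span {p + q}"
      using br_mem_span_square(1)[of "x0 + x" x0] assms subspace_add[OF K_subspace] by simp
    then obtain c where c: "p = s c (p + q)"
      by (auto simp: mem_span_singleton)
    with qp have "c \<noteq> 0" by auto
    with c have "p + q = s (inverse c) p"
      by (metis scale_scale left_inverse scale_one)
    then have "q = s (inverse c) p - p"
      by (simp add: algebra_simps)
    then show False
      using qp by (simp add: span_base span_diff span_scale)
  qed
  then have "span {br x x} \<subseteq> span {br x0 x0}"
    by (simp add: span_minimal)
  then show ?thesis
    using br_mem_span_square(2) assms by blast
qed

section \<open>The action of the algebra on the line of squares\<close>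

context
  fixes x0 z v
  assumes x0: "x0 \<in> K" and z: "z = br x0 x0" and vz: "br v z \<noteq> 0"
begin

lemma z_nonzero: "z \<noteq> 0"
  using vz by auto

lemma z_central: "z \<in> lcenter br K"
  using x0 z square_central by simp

lemma br_mem_span_z: "x \<in> K \<Longrightarrow> y \<in> K \<Longrightarrow> br x y \<in> span {z}"
  using br_mem_span_any_square[OF x0] z z_nonzero by simp

lemma br_z_eigen: "\<exists>d. br u z = s d z"
  using lideal_br_right[OF lideal_span_singleton span_base, of z z u] z_central
  by (auto simp: mem_span_singleton lcenter_iff_square)

text \<open>The ideal spanned by x and [x,x] gives the form of [u,x]. Applying the derivation [u,-]
  to [x,x] multiplies it by 2a and also by d, and [x,x] is nonzero for noncentral x.\<close>

lemma br_noncentral_eigen: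
  assumes "x \<in> K - lcenter br K" and d: "br u z = s d z"
  shows "\<exists>a b. br u x = s a x + s b z \<and> 2 * a = d"
proof -
  have x: "x \<in> K" "br x x \<noteq> 0"
    using assms by (auto simp: lcenter_iff_square)
  obtain c where c: "br x x = s c z"
    using br_mem_span_z[OF x(1) x(1)] by (auto simp: mem_span_singleton)
  obtain a b where ab: "br u x = s a x + s b (br x x)"
    using lideal_br_right[OF lideal_span_square[OF x(1)] span_base, of x u]
    by (auto simp: mem_span_pair)
  have "br x (br x x) = 0"
    using square_central[OF x(1)] x by (auto simp: lcenter_def)
  then have "br (br u x) x + br x (br u x) = s (2 * a) (br x x)"
    unfolding ab mult_2 scale_left_distrib by (simp add: br_linear)
  moreover have "br (br u x) x + br x (br u x) = br u (br x x)"
    by (simp add: leibniz)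
  moreover have "br u (br x x) = s d (br x x)"
    by (simp add: c br_linear d mult.commute)
  ultimately have "2 * a = d"
    using x by simp
  moreover have "br u x = s a x + s (b * c) z"
    by (simp add: ab c)
  ultimately show ?thesis by blast
qed

lemma x0_noncentral: "x0 \<in> K - lcenter br K"
  using x0 z z_nonzero by (simp add: lcenter_iff_square)

text \<open>The eigenvalue of \<open>v\<close> on \<open>z\<close> is nonzero and of the form 2a.
  The type \<open>'a\<close> is the scalar field here.\<close>

lemma two_nonzero: "(2::'a) \<noteq> 0"
proof
  assume "(2::'a) = 0"
  obtain d where d: "br v z = s d z"
    using br_z_eigen by blast
  then have "d = 0"
    using br_noncentral_eigen[OF x0_noncentral d] \<open>2 = 0\<close> by auto
  with d vz show False by simp
qed

lemma lcenter_eq_span_z: "lcenter br K = span {z}"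
proof
  show "span {z} \<subseteq> lcenter br K"
    using z_central subspace_lcenter_K by (simp add: span_minimal)
  obtain d where d: "br v z = s d z"
    using br_z_eigen by blast
  obtain a b where ab: "br v x0 = s a x0 + s b z" "2 * a = d"
    using br_noncentral_eigen[OF x0_noncentral d] by blast
  \<comment> \<open>Comparing the noncentral elements x0 and x0 + w, whose eigenvalues both equal
    d/2, gives [v,w] = a w modulo z. Since Fw is an ideal, [v,w] is also a multiple of w, and w is
    independent of z.\<close>
  have eigen: "br v w = s a w" if w: "w \<in> lcenter br K" "w \<notin> span {z}" for w
  proof -
    have "br (x0 + w) (x0 + w) = z"
      using w x0 by (simp add: lcenter_def br_linear z)
    then have "x0 + w \<in> K - lcenter br K"
      using w x0 K_subspace z_nonzero by (simp add: lcenter_iff_square subspace_add)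
    then obtain a' b' where ab': "br v (x0 + w) = s a' (x0 + w) + s b' z" "2 * a' = d"
      using br_noncentral_eigen d by blast
    have "a' = a"
      using ab(2) ab'(2) two_nonzero by (metis mult_cancel_left)
    then have *: "br v w - s a w = s (b' - b) z"
      using ab'(1) ab(1) by (simp add: br_linear algebra_simps)
    obtain l where l: "br v w = s l w"
      using lideal_br_right[OF lideal_span_singleton span_base, of w w v] w
      by (auto simp: mem_span_singleton lcenter_iff_square)
    have "s (l - a) w \<in> span {z}"
      unfolding scale_left_diff_distrib l[symmetric] * by (simp add: span_base span_scale span_diff)
    then have "s (inverse (l - a)) (s (l - a) w) \<in> span {z}"
      by (rule span_scale)
    then have "l = a"
      using w by (cases "l - a = 0") simp_all
    then show ?thesis using l by simp
  qed
  show "lcenter br K \<subseteq> span {z}"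
  proof (rule subsetI, rule ccontr)
    fix w assume w: "w \<in> lcenter br K" "w \<notin> span {z}"
    \<comment> \<open>\<open>eigen\<close> applies to both w and w + z, so [v,z] = a z. With [v,z] =
      2a z this forces a = 0, hence d = 0.\<close>
    have "w + z \<in> lcenter br K"
      using w z_central subspace_lcenter_K by (simp add: subspace_add)
    moreover have "w + z \<notin> span {z}"
      using w by (metis span_add_eq2 span_base singletonI)
    ultimately have "s d z = s a z"
      using eigen[of "w + z"] eigen[OF w] d by (simp add: br_linear scale_right_distrib)
    then have "d = 0"
      using z_nonzero ab(2)[unfolded mult_2] by (metis add_cancel_right_right scale_right_imp_eq)
    with d vz show False by simp
  qed
qed

text \<open>The Leibniz kernel lies in \<open>K\<close> and its elements have square zero, so it
  lies in the center of \<open>K\<close>, which is the line of \<open>z\<close>.\<close>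

lemma leib_kernel_eq_span_z: "leib_kernel s br = span {z}"
proof
  show "span {z} \<subseteq> leib_kernel s br"
    using square_mem_leib_kernel[of x0] subspace_leib_kernel z by (simp add: span_minimal)
  show "leib_kernel s br \<subseteq> span {z}"
    using leib_kernel_subset_ln_radical[OF radical] br_leib_kernel_left
    by (auto simp: lcenter_eq_span_z[symmetric] lcenter_iff_square)
qed

lemma br_span_K_eq_span_z: "br_span s br K K = span {z}"
proof
  show "span {z} \<subseteq> br_span s br K K"
    using br_mem_br_span[OF x0 x0] by (intro span_minimal) (auto simp: z br_span_def)
  show "br_span s br K K \<subseteq> span {z}"
    using br_mem_span_z by (intro br_span_subset) auto
qed

lemma gen_z_eq_span: "gen_subalgebra s br {z} = span {z}"
proof
  have "br z z = 0"
    using z_central by (simp add: lcenter_iff_square)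
  then show "gen_subalgebra s br {z} \<subseteq> span {z}"
    by (intro gen_minimal subalgebra_span) (auto intro: span_base span_zero)
  show "span {z} \<subseteq> gen_subalgebra s br {z}"
    using gen_superset subalgebra_gen by (intro span_minimal) (auto simp: subalgebra_def)
qed

lemma dim_span_z: "dim (span {z}) = 1"
  using z_nonzero by (simp add: dim_eq_card_independent)

text \<open>For u outside K, the subalgebra Fu + Fz is idealized by x0 without containing it. It is
  therefore an ideal, and its triple products vanish, so it lies in K after all.\<close>

lemma annihilator_of_z_subset:
  assumes "br u z = 0"
  shows "u \<in> K"
proof (rule ccontr)
  assume u: "u \<notin> K"
  have zK: "br z y = 0" for y
    by (simp add: z)
  have square: "br a a \<in> span {z}" for a
    using square_mem_leib_kernel leib_kernel_eq_span_z by blast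
  have z_mem: "span {z} \<subseteq> span {u, z}"
    by (intro span_mono) auto
  have alg: "subalgebra s br (span {u, z})"
    using assms zK square[of u] z_mem by (intro subalgebra_span) (auto simp: span_zero)
  \<comment> \<open>Eigenvalue 0 on \<open>z\<close> means \<open>2 * a = 0\<close> in
    \<open>br_noncentral_eigen\<close>, so only the z-component remains.\<close>
  have ux0: "br u x0 \<in> span {z}"
    using br_noncentral_eigen[OF x0_noncentral, of u 0] assms two_nonzero
    by (auto simp: mem_span_singleton)
  have "br u x0 + br x0 u \<in> span {z}"
    using br_sym_mem_leib_kernel leib_kernel_eq_span_z by blast
  with ux0 have "br x0 u \<in> span {z}"
    by (metis add_diff_cancel_left' span_diff)
  moreover have "br x0 z = 0"
    using z_central x0 by (simp add: lcenter_def)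
  ultimately have gens: "br x0 a \<in> span {u, z}" "br a x0 \<in> span {u, z}" if "a \<in> {u, z}" for a
    using that ux0 z_mem zK span_zero by auto
  have "br x0 t \<in> span {u, z} \<and> br t x0 \<in> span {u, z}" if "t \<in> span {u, z}" for t
  proof
    show "br x0 t \<in> span {u, z}"
      by (rule br_mem_span[OF span_base[of x0 "{x0}"] that subspace_span]) (use gens in auto)
    show "br t x0 \<in> span {u, z}"
      by (rule br_mem_span[OF that span_base[of x0 "{x0}"] subspace_span]) (use gens in auto)
  qed
  then have "x0 \<in> idealizer br (span {u, z})"
    by (simp add: idealizer_def)
  \<comment> \<open>If c = 0 then x0 is a multiple of z and has square zero; otherwise u is a
    combination of x0 and z and lies in \<open>K\<close>.\<close>
  moreover have "x0 \<notin> span {u, z}"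
  proof
    assume "x0 \<in> span {u, z}"
    then obtain c d where cd: "x0 = s c u + s d z"
      by (auto simp: mem_span_pair)
    have "c \<noteq> 0"
    proof
      assume "c = 0"
      then have "br x0 x0 = 0"
        using cd zK by (simp add: br_linear)
      then show False using z z_nonzero by simp
    qed
    moreover have "s c u \<in> K"
      using cd x0 z_central K_subspace
      by (metis DiffD1 add_diff_cancel_right' lcenter_iff_square subspace_diff subspace_scale)
    then have "s (inverse c) (s c u) \<in> K"
      by (rule subspace_scale[OF K_subspace])
    ultimately show False
      using u by simp
  qed
  ultimately have "lideal s br (span {u, z})"
    using dichotomy[OF alg] by (auto simp: self_idealizing_def)
  moreover have "locally_nilpotent s br (span {u, z})"
  proof (rule locally_nilpotent_class_two[OF alg])
    fix a b c assume abc: "a \<in> span {u, z}" "b \<in> span {u, z}" "c \<in> span {u, z}"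
    have "br b c \<in> span {z}"
      using abc(2,3) by (rule br_mem_span) (auto simp: assms zK square span_zero)
    with abc(1) show "br a (br b c) = 0"
      using br_mem_span[where V = "{0}" and A = "{u, z}" and B = "{z}"] assms zK by auto
  qed
  ultimately have "span {u, z} \<subseteq> K"
    using radical by (simp add: is_ln_radical_def)
  with u show False
    using span_base[of u "{u, z}"] by blast
qed

lemma K_strong_extraspecial: "strong_extraspecial s br K"
proof -
  let ?Z = "lcenter br K"
  have "quot_br br ?Z (lcoset ?Z x) (lcoset ?Z y) = lcoset ?Z 0" if "x \<in> K" "y \<in> K" for x y
  proof -
    have "quot_br br ?Z (lcoset ?Z x) (lcoset ?Z y) = lcoset ?Z (br x y)"
      using that subspace_lcenter_K
      by (intro quot_br_lcoset[where A = K]) (auto simp: lcenter_def subspace_0 K_subspace)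
    also have "br x y \<in> ?Z"
      using that br_mem_span_z lcenter_eq_span_z by simp
    then have "lcoset ?Z (br x y) = lcoset ?Z 0"
      using lcoset_add_mem[OF subspace_lcenter_K, of "br x y" 0] by simp
    finally show ?thesis .
  qed
  then show ?thesis
    unfolding strong_extraspecial_def extraspecial_def
    using K_subalgebra dim_span_z[folded lcenter_eq_span_z]
    by (auto simp: lquot_def lcenter_iff_square)
qed

lemma normalized_action:
  obtains v' where "br v' z = s 2 z"
    "\<And>x. x \<in> K \<Longrightarrow> br v' x - x \<in> span {z} \<or> x \<in> lcenter br K"
    "\<And>u. \<exists>k c. k \<in> K \<and> u = k + s c v'"
proof -
  obtain d where d: "br v z = s d z"
    using br_z_eigen by blast
  with vz have "d \<noteq> 0" by auto
  \<comment> \<open>The factor 2/d makes the eigenvalue on \<open>z\<close> equal to 2, and hence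
    the one on noncentral elements modulo \<open>z\<close> equal to 1.\<close>
  define v' where "v' = s (2 / d) v"
  have v'z: "br v' z = s 2 z"
    using \<open>d \<noteq> 0\<close> by (simp add: v'_def br_linear d)
  moreover have "br v' x - x \<in> span {z} \<or> x \<in> lcenter br K" if x: "x \<in> K" for x
  proof (rule disjCI)
    assume "x \<notin> lcenter br K"
    then obtain a b where "br v' x = s a x + s b z" "2 * a = 2"
      using br_noncentral_eigen[OF _ v'z, of x] x by blast
    then show "br v' x - x \<in> span {z}"
      using two_nonzero by (auto simp: mem_span_singleton)
  qed
  moreover have "\<exists>k c. k \<in> K \<and> u = k + s c v'" for u
  proof -
    obtain e where e: "br u z = s e z"
      using br_z_eigen by blast
    \<comment> \<open>Subtracting e/2 times v' cancels the eigenvalue e of u on z, so the difference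
      falls into \<open>K\<close>.\<close>
    have "br (u - s (e / 2) v') z = 0"
      using two_nonzero by (simp add: br_linear e v'z)
    then have "u - s (e / 2) v' \<in> K"
      by (rule annihilator_of_z_subset)
    then show ?thesis
      by (metis diff_add_cancel)
  qed
  ultimately show thesis by (rule that)
qed

end

end

section \<open>Choice of x0, z and v, and collection of the conclusions\<close>

theorem theoremB2:
  fixes s :: "'f::field \<Rightarrow> 'a::ab_group_add \<Rightarrow> 'a"
    and br :: "'a \<Rightarrow> 'a \<Rightarrow> 'a"
    and K :: "'a set"
  assumes "left_leibniz_algebra s br"
    and "\<not> is_lie br"
    and "\<forall>S. subalgebra s br S \<longrightarrow> lideal s br S \<or> self_idealizing br S"
    and "is_ln_radical s br K"
    and "UNIV \<noteq> K"
    and "\<not> cyclic_alg s br K"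
    and "\<not> abelian_alg br K"
    and "\<not> br_span s br K K \<subseteq> lcenter br UNIV"
  shows "CHAR('f) \<noteq> 2 \<and>
    (\<forall>S. subalgebra s br S \<and> S \<subseteq> K \<longrightarrow> lideal s br S) \<and>
    strong_extraspecial s br K \<and>
    (\<exists>z. br_span s br K K = lcenter br K \<and>
         lcenter br K = leib_kernel s br \<and>
         leib_kernel s br = gen_subalgebra s br {z} \<and>
         vector_space.dim s (gen_subalgebra s br {z}) = 1 \<and>
         (\<exists>v. UNIV = {k + w | k w. k \<in> K \<and> w \<in> gen_subalgebra s br {v}} \<and>
              (\<forall>x\<in>K - lcenter br K.
                 quot_br br (lcenter br K) (lcoset (lcenter br K) v) (lcoset (lcenter br K) x)
                   = lcoset (lcenter br K) x) \<and>
              br v z = s 2 z \<and>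
              (\<exists>\<nu>. br v v = s \<nu> z)))"
proof -
  interpret leibniz_ideal_or_self_idealizing s br K
    using assms(1,3,4,6)
    by (simp add: leibniz_ideal_or_self_idealizing_def leibniz_ideal_or_self_idealizing_axioms_def)
  have "\<exists>x\<in>K. \<exists>y\<in>K. br x y \<notin> lcenter br UNIV"
  proof (rule ccontr)
    assume "\<not> ?thesis"
    moreover have "subspace (lcenter br UNIV)"
      by (simp add: subspace_lcenter)
    ultimately show False
      using assms(8) br_span_subset[of "lcenter br UNIV" K K] by blast
  qed
  then obtain x0 y where xy: "x0 \<in> K" "y \<in> K" "br x0 y \<notin> lcenter br UNIV"
    by blast
  define z where "z = br x0 x0"
  obtain c where c: "br x0 y = s c z"
    using br_mem_span_square(2)[OF xy(1,2)] by (auto simp: mem_span_singleton z_def)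
  \<comment> \<open>The square \<open>z\<close> annihilates everything from the left, so a
    noncentral multiple of it can only be detected by a product [v,z].\<close>
  have "\<exists>v. br v z \<noteq> 0"
    using xy(3) unfolding c by (auto simp: lcenter_def br_linear) (simp add: z_def)
  then obtain v0 where v0: "br v0 z \<noteq> 0" by blast
  note ctx = xy(1) z_def v0
  obtain v where v: "br v z = s 2 z"
      "\<And>x. x \<in> K \<Longrightarrow> br v x - x \<in> span {z} \<or> x \<in> lcenter br K"
      "\<And>u. \<exists>k c. k \<in> K \<and> u = k + s c v"
    using normalized_action[OF ctx] by blast
  note Z = lcenter_eq_span_z[OF ctx]
  have "CHAR('f) \<noteq> 2"
    using two_nonzero[OF ctx] of_nat_CHAR[where 'a = 'f] by (metis of_nat_numeral)
  moreover have "UNIV = {k + w | k w. k \<in> K \<and> w \<in> gen_subalgebra s br {v}}"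
  proof -
    have "s c v \<in> gen_subalgebra s br {v}" for c
      using gen_superset[of "{v}"] subalgebra_gen[of "{v}"]
      by (auto simp: subalgebra_def intro: subspace_scale)
    then show ?thesis
      using v(3) by blast
  qed
  moreover have "quot_br br (lcenter br K) (lcoset (lcenter br K) v) (lcoset (lcenter br K) x)
      = lcoset (lcenter br K) x" if "x \<in> K - lcenter br K" for x
  proof -
    \<comment> \<open>\<open>v\<close> lies outside \<open>K\<close>, so the coset product is
      computed in the whole algebra, where the line of \<open>z\<close> is an ideal because it is
      the Leibniz kernel.\<close>
    have I: "lideal s br (span {z})"
      using lideal_leib_kernel leib_kernel_eq_span_z[OF ctx] by simp
    have "quot_br br (span {z}) (lcoset (span {z}) v) (lcoset (span {z}) x)
        = lcoset (span {z}) (br v x)"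
      using I by (intro quot_br_lcoset[where A = UNIV]) (auto simp: lideal_def)
    also have "\<dots> = lcoset (span {z}) x"
      using v(2)[of x] that lcoset_add_mem[OF subspace_span, of "br v x - x" "{z}" x] by auto
    finally show ?thesis unfolding Z .
  qed
  moreover have "\<exists>\<nu>. br v v = s \<nu> z"
    using square_mem_leib_kernel[of v] leib_kernel_eq_span_z[OF ctx]
    by (simp add: mem_span_singleton)
  ultimately show ?thesis
    using subalgebra_imp_lideal K_strong_extraspecial[OF ctx] br_span_K_eq_span_z[OF ctx]
      Z leib_kernel_eq_span_z[OF ctx] gen_z_eq_span[OF ctx] dim_span_z[OF ctx] v(1)
    by (intro conjI exI[of _ z] exI[of _ v]) auto
qed

end
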